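(* Let $(\rho_n)_{n\in\mathbb{N}}$ be a sequence of profiles on $I=[a,b]$ with unique interior maximizers $\alpha_n$ and scales $\tau_n=\lambda_n^{-1/2}$ as described in the context. Assume: (i) $\dfrac{\operatorname{dist}(\alpha_n,\partial I)}{\tau_n}\to\infty$ as $n\to\infty$; (ii) $\omega_n(M)\to0$ as $n\to\infty$ for every fixed $M>0$; (iii) $\displaystyle\lim_{M\to\infty}\limsup_{n\to\infty}\frac1{m_n\tau_n}\int_{\{\theta\in I:\,|\theta-\alpha_n|>M\tau_n\}}\rho_n(\theta)\,d\theta=0.$ Then $$\int_{\mathbb{R}}|p_n(y)-\varphi(y)|\,dy\longrightarrow0,\qquad d_{\rm TV}(p_n,\varphi):=\frac12\int_{\mathbb{R}}|p_n(y)-\varphi(y)|\,dy\longrightarrow0 .$$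
   Context: Let $I=[a,b]\subset\mathbb{R}$ be a fixed compact interval. For each $n\in\mathbb{N}$, $\rho_n:I\to[0,\infty)$ is continuous with $0<\int_I\rho_n<\infty$; $m_n=\max_I\rho_n$; the set of maximizers $\{\theta\in I:\rho_n(\theta)=m_n\}$ is a single point $\{\alpha_n\}$ with $\alpha_n\in(a,b)$; $\rho_n>0$ on $(a,b)$; $V_n:=\log\rho_n\in C^2((a,b))$; and $V_n''(\alpha_n)<0$. Set $$\lambda_n:=-V_n''(\alpha_n)>0,\qquad \tau_n:=\lambda_n^{-1/2},$$ $$\omega_n(M):=\frac1{\lambda_n}\sup_{\theta\in(a,b),\ |\theta-\alpha_n|\le M\tau_n}|V_n''(\theta)-V_n''(\alpha_n)|\qquad(M>0).$$ Define $h_n(y)=\rho_n(\alpha_n+\tau_ny)/m_n$ if $\alpha_n+\tau_ny\in I$ and $h_n(y)=0$ otherwise; $c_n=\int_{\mathbb{R}}h_n(s)\,ds$; and $p_n(y)=h_n(y)/c_n$. Also $\varphi(y)=(2\pi)^{-1/2}e^{-y^2/2}$. *)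

theory Defs
  imports "HOL-Probability.Probability"
begin

text \<open>
  A profile on the interval \<open>[a, b]\<close> is a function \<open>\<rho> :: real \<Rightarrow> real\<close> of which only the values on
  \<open>[a, b]\<close> matter. The definitions below concern a single profile \<open>\<rho>\<close> with maximizer \<open>\<alpha>\<close>; in a
  sequence of profiles they are used with \<open>\<rho> n\<close> and \<open>\<alpha> n\<close>.
\<close>

definition max_value :: "real \<Rightarrow> real \<Rightarrow> (real \<Rightarrow> real) \<Rightarrow> real" where
  "max_value a b \<rho> = (SUP \<theta>\<in>{a..b}. \<rho> \<theta>)"

text \<open>Only meaningful on \<open>(a, b)\<close>, where a profile is positive.\<close>

definition log_profile :: "(real \<Rightarrow> real) \<Rightarrow> real \<Rightarrow> real" where
  "log_profile \<rho> = (\<lambda>\<theta>. ln (\<rho> \<theta>))"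

text \<open>\<open>C\<^sup>2\<close> regularity, intended for open sets \<open>S\<close>.\<close>

definition C2_on :: "real set \<Rightarrow> (real \<Rightarrow> real) \<Rightarrow> bool" where
  "C2_on S f \<longleftrightarrow>
     (\<forall>x\<in>S. f field_differentiable at x) \<and>
     (\<forall>x\<in>S. deriv f field_differentiable at x) \<and>
     continuous_on S (deriv (deriv f))"

abbreviation log_profile'' :: "(real \<Rightarrow> real) \<Rightarrow> real \<Rightarrow> real" where
  "log_profile'' \<rho> \<equiv> deriv (deriv (log_profile \<rho>))"

definition profile :: "real \<Rightarrow> real \<Rightarrow> (real \<Rightarrow> real) \<Rightarrow> real \<Rightarrow> bool" where
  "profile a b \<rho> \<alpha> \<longleftrightarrow>
     continuous_on {a..b} \<rho> \<and>
     (\<forall>\<theta>\<in>{a..b}. 0 \<le> \<rho> \<theta>) \<and>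
     set_integrable lborel {a..b} \<rho> \<and>
     0 < (LINT \<theta>:{a..b}|lborel. \<rho> \<theta>) \<and>
     {\<theta>\<in>{a..b}. \<rho> \<theta> = max_value a b \<rho>} = {\<alpha>} \<and>
     \<alpha> \<in> {a<..<b} \<and>
     (\<forall>\<theta>\<in>{a<..<b}. 0 < \<rho> \<theta>) \<and>
     C2_on {a<..<b} (log_profile \<rho>) \<and>
     log_profile'' \<rho> \<alpha> < 0"

definition curvature :: "(real \<Rightarrow> real) \<Rightarrow> real \<Rightarrow> real" where
  "curvature \<rho> \<alpha> = - log_profile'' \<rho> \<alpha>"

definition peak_scale :: "(real \<Rightarrow> real) \<Rightarrow> real \<Rightarrow> real" where
  "peak_scale \<rho> \<alpha> = curvature \<rho> \<alpha> powr (- (1 / 2))"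

text \<open>
  The second derivative of the logarithm may be unbounded near the end points of the interval,
  so the supremum is taken in the extended reals.
\<close>

definition osc :: "real \<Rightarrow> real \<Rightarrow> (real \<Rightarrow> real) \<Rightarrow> real \<Rightarrow> real \<Rightarrow> ereal" where
  "osc a b \<rho> \<alpha> M =
     ereal (1 / curvature \<rho> \<alpha>) *
     (SUP \<theta>\<in>{\<theta>\<in>{a<..<b}. \<bar>\<theta> - \<alpha>\<bar> \<le> M * peak_scale \<rho> \<alpha>}.
        ereal \<bar>log_profile'' \<rho> \<theta> - log_profile'' \<rho> \<alpha>\<bar>)"

definition tail_mass :: "real \<Rightarrow> real \<Rightarrow> (real \<Rightarrow> real) \<Rightarrow> real \<Rightarrow> real \<Rightarrow> real" where
  "tail_mass a b \<rho> \<alpha> M =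
     1 / (max_value a b \<rho> * peak_scale \<rho> \<alpha>) *
     (LINT \<theta>:{\<theta>\<in>{a..b}. \<bar>\<theta> - \<alpha>\<bar> > M * peak_scale \<rho> \<alpha>}|lborel. \<rho> \<theta>)"

definition rescaled :: "real \<Rightarrow> real \<Rightarrow> (real \<Rightarrow> real) \<Rightarrow> real \<Rightarrow> real \<Rightarrow> real" where
  "rescaled a b \<rho> \<alpha> y =
     (if \<alpha> + peak_scale \<rho> \<alpha> * y \<in> {a..b}
      then \<rho> (\<alpha> + peak_scale \<rho> \<alpha> * y) / max_value a b \<rho> else 0)"

definition rescaled_density :: "real \<Rightarrow> real \<Rightarrow> (real \<Rightarrow> real) \<Rightarrow> real \<Rightarrow> real \<Rightarrow> real" where
  "rescaled_density a b \<rho> \<alpha> y =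
     rescaled a b \<rho> \<alpha> y / (LINT s|lborel. rescaled a b \<rho> \<alpha> s)"

definition tv_dist :: "(real \<Rightarrow> real) \<Rightarrow> (real \<Rightarrow> real) \<Rightarrow> real" where
  "tv_dist p q = 1 / 2 * (LINT y|lborel. \<bar>p y - q y\<bar>)"

end

theory Submission
  imports Defs
begin

text \<open>
  Write \<open>h\<close> for the rescaled profile and \<open>g y = exp (- y\<^sup>2 / 2)\<close>. As \<open>ln h\<close> has a critical point at
  \<open>0\<close> with second derivative \<open>-1\<close> there, Taylor's formula bounds \<open>\<bar>ln h y + y\<^sup>2 / 2\<bar>\<close> by the oscillation
  times \<open>M\<^sup>2 / 2\<close> on \<open>\<bar>y\<bar> \<le> M\<close>. Both logarithms are nonpositive and \<open>exp\<close> is 1-Lipschitz there, so the same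
  bound holds for \<open>\<bar>h - g\<bar>\<close>. Outside \<open>\<bar>y\<bar> \<le> M\<close> the masses of \<open>h\<close> and \<open>g\<close> are small separately, whence
  \<open>h \<longlongrightarrow> g\<close> in \<open>L\<^sup>1\<close>. Normalising costs only a factor \<open>2\<close> relative to the mass of \<open>g\<close>.
\<close>

section \<open>Estimates for the exponential, for normalisation in L1, and for Gaussian
  integrals\<close>

lemma abs_exp_diff_le:
  fixes u v :: real
  assumes "u \<le> 0" "v \<le> 0"
  shows "\<bar>exp u - exp v\<bar> \<le> \<bar>u - v\<bar>"
proof -
  have *: "exp y - exp x \<le> y - x" if "x \<le> y" "y \<le> 0" for x y :: real
  proof -
    \<comment> \<open>The tangent line bound for \<open>exp\<close> at 0; multiplying it by
      \<open>exp y\<close>, which is at most 1 as y is nonpositive, gives the claim.\<close>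
    have "1 - exp (x - y) \<le> y - x"
      using exp_ge_add_one_self[of "x - y"] by linarith
    moreover have "0 \<le> 1 - exp (x - y)" "exp y \<le> 1"
      using that by auto
    ultimately have "exp y * (1 - exp (x - y)) \<le> 1 * (y - x)"
      by (intro mult_mono) (use that in auto)
    then show ?thesis
      by (simp add: algebra_simps flip: exp_add)
  qed
  show ?thesis
    using *[of u v] *[of v u] assms by (cases "u \<le> v") (auto simp: abs_if)
qed

text \<open>With masses F and G, split f/F - g/G as (f - g)/G + f (1/F - 1/G). The second term has
  L1 norm |F - G|/G, again at most the L1 distance of f and g over G; this is the source of the
  factor 2. Dividing by G alone keeps the bound uniform when f varies and g is fixed.\<close>

lemma L1_dist_normalized_le:
  fixes f g :: "'a \<Rightarrow> real"
  assumes f: "integrable M f" and g: "integrable M g"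
    and f_nonneg: "\<And>x. 0 \<le> f x"
    and f_pos: "0 < (LINT x|M. f x)" and g_pos: "0 < (LINT x|M. g x)"
  shows "(LINT x|M. \<bar>f x / (LINT x|M. f x) - g x / (LINT x|M. g x)\<bar>)
           \<le> 2 * (LINT x|M. \<bar>f x - g x\<bar>) / (LINT x|M. g x)"
proof -
  define F where "F = (LINT x|M. f x)"
  define G where "G = (LINT x|M. g x)"
  have pos: "0 < F" "0 < G"
    using f_pos g_pos by (auto simp: F_def G_def)
  have d: "integrable M (\<lambda>x. \<bar>f x - g x\<bar>)"
    using f g by auto
  have "\<bar>f x / F - g x / G\<bar> \<le> \<bar>f x - g x\<bar> / G + f x * \<bar>1 / F - 1 / G\<bar>" for x
  proof -
    have "f x / F - g x / G = (f x - g x) / G + f x * (1 / F - 1 / G)"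
      by (simp add: field_simps diff_divide_distrib)
    moreover have "\<bar>(f x - g x) / G + f x * (1 / F - 1 / G)\<bar>
        \<le> \<bar>(f x - g x) / G\<bar> + \<bar>f x * (1 / F - 1 / G)\<bar>"
      by (rule abs_triangle_ineq)
    ultimately show ?thesis
      using pos f_nonneg[of x] by (simp add: abs_mult)
  qed
  then have "(LINT x|M. \<bar>f x / F - g x / G\<bar>)
      \<le> (LINT x|M. \<bar>f x - g x\<bar> / G + f x * \<bar>1 / F - 1 / G\<bar>)"
    using f g d by (intro integral_mono) auto
  also have "\<dots> = (LINT x|M. \<bar>f x - g x\<bar>) / G + F * \<bar>1 / F - 1 / G\<bar>"
    using f d by (simp add: F_def)
  also have "F * \<bar>1 / F - 1 / G\<bar> = \<bar>F * (1 / F - 1 / G)\<bar>"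
    using pos by (simp add: abs_mult)
  also have "F * (1 / F - 1 / G) = (G - F) / G"
    using pos by (simp add: field_simps)
  also have "\<bar>(G - F) / G\<bar> = \<bar>F - G\<bar> / G"
    using pos by simp
  also have "\<bar>F - G\<bar> \<le> (LINT x|M. \<bar>f x - g x\<bar>)"
  proof -
    have "F - G = (LINT x|M. f x - g x)"
      using f g by (simp add: F_def G_def)
    then show ?thesis
      by (simp add: integral_abs_bound)
  qed
  finally show ?thesis
    using pos by (simp add: F_def G_def divide_right_mono)
qed

text \<open>Dominated convergence with majorant |f|: at a fixed y the indicator vanishes once M
  reaches |y|.\<close>

lemma integral_outside_ball_tendsto_0:
  fixes f :: "real \<Rightarrow> real"
  assumes "integrable lborel f"
  shows "((\<lambda>M. LINT y:{y. M < \<bar>y\<bar>}|lborel. f y) \<longlongrightarrow> 0) at_top"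
proof -
  have "((\<lambda>M. LINT y|lborel. indicator {y. M < \<bar>y\<bar>} y *\<^sub>R f y) \<longlongrightarrow> (LINT y::real|lborel. (0::real))) at_top"
  proof (rule integral_dominated_convergence_at_top[where w = "\<lambda>y. \<bar>f y\<bar>"])
    show "AE y in lborel. ((\<lambda>M. indicator {y. M < \<bar>y\<bar>} y *\<^sub>R f y) \<longlongrightarrow> 0) at_top"
    proof (rule AE_I2)
      fix y :: real
      have "\<forall>\<^sub>F M in at_top. indicator {y. M < \<bar>y\<bar>} y *\<^sub>R f y = 0"
        using eventually_ge_at_top[of "\<bar>y\<bar>"] by eventually_elim auto
      then show "((\<lambda>M. indicator {y. M < \<bar>y\<bar>} y *\<^sub>R f y) \<longlongrightarrow> 0) at_top"
        by (rule tendsto_eventually)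
    qed
  qed (use assms in \<open>auto simp: indicator_def\<close>)
  then show ?thesis
    by (simp add: set_lebesgue_integral_def)
qed

lemma exp_neg_half_square_eq:
  fixes y :: real
  shows "exp (- y\<^sup>2 / 2) = sqrt (2 * pi) * std_normal_density y"
  by (simp add: std_normal_density_def)

lemma integrable_exp_neg_half_square: "integrable lborel (\<lambda>y::real. exp (- y\<^sup>2 / 2))"
  unfolding exp_neg_half_square_eq by simp

lemma integral_exp_neg_half_square:
  "(LINT y::real|lborel. exp (- y\<^sup>2 / 2)) = sqrt (2 * pi)"
  unfolding exp_neg_half_square_eq by simp

section \<open>Maximum, curvature and logarithmic Taylor expansion of a profile\<close>

lemma max_value_upper:
  assumes "profile a b \<rho> \<alpha>" "\<theta> \<in> {a..b}"
  shows "\<rho> \<theta> \<le> max_value a b \<rho>"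
proof -
  have "compact (\<rho> ` {a..b})"
    using assms(1) by (intro compact_continuous_image) (auto simp: profile_def)
  then have "bdd_above (\<rho> ` {a..b})"
    by (intro bounded_imp_bdd_above compact_imp_bounded)
  then show ?thesis
    using assms(2) unfolding max_value_def by (intro cSUP_upper)
qed

lemma max_value_eq:
  assumes "profile a b \<rho> \<alpha>"
  shows "\<rho> \<alpha> = max_value a b \<rho>"
  using assms unfolding profile_def by blast

lemma max_value_pos:
  assumes "profile a b \<rho> \<alpha>"
  shows "0 < max_value a b \<rho>"
  using max_value_eq[OF assms] assms unfolding profile_def by metis

lemma curvature_pos: "profile a b \<rho> \<alpha> \<Longrightarrow> 0 < curvature \<rho> \<alpha>"
  by (simp add: profile_def curvature_def)

lemma peak_scale_pos: "profile a b \<rho> \<alpha> \<Longrightarrow> 0 < peak_scale \<rho> \<alpha>"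
  using curvature_pos[of a b \<rho> \<alpha>] by (simp add: peak_scale_def)

text \<open>This identity makes the second derivative at 0 of the logarithm of the rescaled profile
  equal to -1.\<close>

lemma curvature_mult_peak_scale_square:
  assumes "profile a b \<rho> \<alpha>"
  shows "curvature \<rho> \<alpha> * (peak_scale \<rho> \<alpha>)\<^sup>2 = 1"
proof -
  have "(peak_scale \<rho> \<alpha>)\<^sup>2 = curvature \<rho> \<alpha> powr (-1)"
    by (simp add: peak_scale_def power2_eq_square flip: powr_add)
  then show ?thesis
    using curvature_pos[OF assms] by (simp add: powr_minus)
qed

text \<open>Since \<open>ln\<close> is increasing, \<alpha> also maximizes the log profile, and it
  is an interior point, so Fermat's criterion applies.\<close>

lemma deriv_log_profile_maximizer:
  assumes "profile a b \<rho> \<alpha>"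
  shows "deriv (log_profile \<rho>) \<alpha> = 0"
proof (rule DERIV_local_max)
  have \<alpha>: "a < \<alpha>" "\<alpha> < b" and C2: "C2_on {a<..<b} (log_profile \<rho>)"
    using assms by (auto simp: profile_def)
  show "DERIV (log_profile \<rho>) \<alpha> :> deriv (log_profile \<rho>) \<alpha>"
    using C2 \<alpha> by (auto simp: C2_on_def DERIV_deriv_iff_field_differentiable)
  \<comment> \<open>This radius keeps the neighbourhood inside (a, b), where the profile is positive
    and \<open>ln\<close> is monotone.\<close>
  show "0 < min (\<alpha> - a) (b - \<alpha>)"
    using \<alpha> by simp
  show "\<forall>y. \<bar>\<alpha> - y\<bar> < min (\<alpha> - a) (b - \<alpha>) \<longrightarrow> log_profile \<rho> y \<le> log_profile \<rho> \<alpha>"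
  proof (intro allI impI)
    fix y assume "\<bar>\<alpha> - y\<bar> < min (\<alpha> - a) (b - \<alpha>)"
    then have y: "y \<in> {a<..<b}" by auto
    then have "0 < \<rho> y" using assms by (auto simp: profile_def)
    moreover have "\<rho> y \<le> \<rho> \<alpha>"
      using max_value_upper[OF assms, of y] max_value_eq[OF assms] y by auto
    ultimately show "log_profile \<rho> y \<le> log_profile \<rho> \<alpha>"
      by (simp add: log_profile_def)
  qed
qed

text \<open>Second-order Taylor expansion with Lagrange remainder about \<alpha>, whose linear term
  vanishes at the maximizer. The intermediate point is no farther from \<alpha> than \<theta> is, so
  an oscillation bound that covers \<theta> covers it too.\<close>

lemma log_profile_taylor:
  assumes "profile a b \<rho> \<alpha>" "\<theta> \<in> {a<..<b}"
  obtains \<xi> where "\<xi> \<in> {a<..<b}" "\<bar>\<xi> - \<alpha>\<bar> \<le> \<bar>\<theta> - \<alpha>\<bar>"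
    "log_profile \<rho> \<theta> = log_profile \<rho> \<alpha> + log_profile'' \<rho> \<xi> / 2 * (\<theta> - \<alpha>)\<^sup>2"
proof (cases "\<theta> = \<alpha>")
  case True
  then show ?thesis using that[of \<theta>] assms by simp
next
  case False
  have \<alpha>: "a < \<alpha>" "\<alpha> < b" and C2: "C2_on {a<..<b} (log_profile \<rho>)"
    using assms by (auto simp: profile_def)
  define diff where "diff m = (deriv ^^ m) (log_profile \<rho>)" for m
  \<comment> \<open>The closed interval spanned by \<theta> and \<alpha> lies in (a, b), so
    regularity on the open interval supplies all derivatives for \<open>Taylor\<close>.\<close>
  have DERIV: "\<forall>m t. m < 2 \<and> min \<theta> \<alpha> \<le> t \<and> t \<le> max \<theta> \<alpha> \<longrightarrow> DERIV (diff m) t :> diff (Suc m) t"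
  proof (intro allI impI)
    fix m t assume m: "m < (2::nat) \<and> min \<theta> \<alpha> \<le> t \<and> t \<le> max \<theta> \<alpha>"
    then have "t \<in> {a<..<b}" using \<alpha> assms(2) by auto
    with m show "DERIV (diff m) t :> diff (Suc m) t"
      using C2
      by (auto simp: C2_on_def DERIV_deriv_iff_field_differentiable diff_def less_2_cases_iff)
  qed
  obtain t where t: "if \<theta> < \<alpha> then \<theta> < t \<and> t < \<alpha> else \<alpha> < t \<and> t < \<theta>"
    and eq: "log_profile \<rho> \<theta> = (\<Sum>m<2. (diff m \<alpha> / fact m) * (\<theta> - \<alpha>) ^ m) + (diff 2 t / fact 2) * (\<theta> - \<alpha>)\<^sup>2"
    using Taylor[where n = 2 and diff = diff and f = "log_profile \<rho>" and c = \<alpha> and x = \<theta>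
        and a = "min \<theta> \<alpha>" and b = "max \<theta> \<alpha>"] DERIV False
    by (auto simp: diff_def)
  show ?thesis
  proof (rule that[of t])
    show "t \<in> {a<..<b}" "\<bar>t - \<alpha>\<bar> \<le> \<bar>\<theta> - \<alpha>\<bar>"
      using t \<alpha> assms(2) by (auto split: if_splits)
    show "log_profile \<rho> \<theta> = log_profile \<rho> \<alpha> + log_profile'' \<rho> t / 2 * (\<theta> - \<alpha>)\<^sup>2"
      using eq deriv_log_profile_maximizer[OF assms(1)]
      by (simp add: diff_def numeral_2_eq_2)
  qed
qed

text \<open>Passes from the extended-real supremum to a real pointwise estimate; positivity of the
  curvature lets the factor change sides.\<close>

lemma osc_bound:
  assumes "profile a b \<rho> \<alpha>" "osc a b \<rho> \<alpha> M \<le> ereal e"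
    and "\<theta> \<in> {a<..<b}" "\<bar>\<theta> - \<alpha>\<bar> \<le> M * peak_scale \<rho> \<alpha>"
  shows "\<bar>log_profile'' \<rho> \<theta> - log_profile'' \<rho> \<alpha>\<bar> \<le> e * curvature \<rho> \<alpha>"
proof -
  have "ereal (1 / curvature \<rho> \<alpha>) * ereal \<bar>log_profile'' \<rho> \<theta> - log_profile'' \<rho> \<alpha>\<bar> \<le> osc a b \<rho> \<alpha> M"
    unfolding osc_def using assms(3,4) curvature_pos[OF assms(1)]
    by (intro ereal_mult_left_mono SUP_upper) auto
  then have "ereal (1 / curvature \<rho> \<alpha> * \<bar>log_profile'' \<rho> \<theta> - log_profile'' \<rho> \<alpha>\<bar>) \<le> ereal e"
    using assms(2) by (simp del: ereal_less_eq)
  then show ?thesis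
    using curvature_pos[OF assms(1)] by (simp add: field_simps)
qed

section \<open>The rescaled profile: comparison with the Gaussian, mass and tails\<close>

lemma rescaled_nonneg:
  assumes "profile a b \<rho> \<alpha>"
  shows "0 \<le> rescaled a b \<rho> \<alpha> y"
  using assms max_value_pos[OF assms] by (auto simp: rescaled_def profile_def)

lemma rescaled_near_gaussian:
  assumes P: "profile a b \<rho> \<alpha>" and osc: "osc a b \<rho> \<alpha> M \<le> ereal e"
    and inside: "\<alpha> + peak_scale \<rho> \<alpha> * y \<in> {a<..<b}" and y: "\<bar>y\<bar> \<le> M"
  shows "\<bar>rescaled a b \<rho> \<alpha> y - exp (- y\<^sup>2 / 2)\<bar> \<le> e * M\<^sup>2 / 2"
proof -
  define \<tau> where "\<tau> = peak_scale \<rho> \<alpha>"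
  define \<kappa> where "\<kappa> = curvature \<rho> \<alpha>"
  define \<theta> where "\<theta> = \<alpha> + \<tau> * y"
  have \<tau>: "0 < \<tau>" and \<kappa>: "0 < \<kappa>" and \<kappa>\<tau>: "\<kappa> * \<tau>\<^sup>2 = 1"
    using peak_scale_pos[OF P] curvature_pos[OF P] curvature_mult_peak_scale_square[OF P]
    by (auto simp: \<tau>_def \<kappa>_def)
  have \<theta>: "\<theta> \<in> {a<..<b}" using inside by (simp add: \<theta>_def \<tau>_def)
  have pos: "0 < \<rho> \<theta>" "0 < \<rho> \<alpha>" and \<rho>\<alpha>: "\<rho> \<alpha> = max_value a b \<rho>"
    using P \<theta> max_value_pos[OF P] max_value_eq[OF P] by (auto simp: profile_def)
  have "\<rho> \<theta> \<le> \<rho> \<alpha>"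
    using max_value_upper[OF P, of \<theta>] \<theta> \<rho>\<alpha> by simp
  \<comment> \<open>Dividing by the maximum subtracts the log profile at \<alpha>, so W is the
    logarithm of the rescaled profile at y.\<close>
  define W where "W = log_profile \<rho> \<theta> - log_profile \<rho> \<alpha>"
  have W: "W \<le> 0"
    using pos \<open>\<rho> \<theta> \<le> \<rho> \<alpha>\<close> by (simp add: W_def log_profile_def)
  have h: "rescaled a b \<rho> \<alpha> y = exp W"
    using \<theta> pos \<rho>\<alpha> by (simp add: rescaled_def W_def log_profile_def exp_diff \<theta>_def \<tau>_def)
  obtain \<xi> where \<xi>: "\<xi> \<in> {a<..<b}" "\<bar>\<xi> - \<alpha>\<bar> \<le> \<bar>\<theta> - \<alpha>\<bar>"
    "log_profile \<rho> \<theta> = log_profile \<rho> \<alpha> + log_profile'' \<rho> \<xi> / 2 * (\<theta> - \<alpha>)\<^sup>2"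
    using log_profile_taylor[OF P \<theta>] by blast
  have "\<bar>\<theta> - \<alpha>\<bar> \<le> M * \<tau>"
    using y \<tau> by (simp add: \<theta>_def abs_mult mult.commute)
  then have bound: "\<bar>log_profile'' \<rho> \<xi> - log_profile'' \<rho> \<alpha>\<bar> \<le> e * \<kappa>"
    using osc_bound[OF P osc \<xi>(1)] \<xi>(2) by (simp add: \<kappa>_def \<tau>_def)
  \<comment> \<open>The sign of e is read off from the bound on an absolute value; it is used below
    to replace y by M.\<close>
  then have "0 \<le> e * \<kappa>" by linarith
  then have e: "0 \<le> e" using \<kappa> by (simp add: zero_le_mult_iff)
  \<comment> \<open>Writing 1 as \<open>\<kappa> * \<tau>\<^sup>2\<close> in front of the Gaussian
    exponent gives both terms the same quadratic factor, leaving the difference of second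
    derivatives.\<close>
  have "W - (- y\<^sup>2 / 2) = log_profile'' \<rho> \<xi> / 2 * (\<tau> * y)\<^sup>2 + \<kappa> * \<tau>\<^sup>2 * y\<^sup>2 / 2"
    using \<xi>(3) \<kappa>\<tau> by (simp add: W_def \<theta>_def)
  also have "\<dots> = (log_profile'' \<rho> \<xi> - log_profile'' \<rho> \<alpha>) * (\<tau>\<^sup>2 * y\<^sup>2 / 2)"
    by (simp add: \<kappa>_def curvature_def algebra_simps power_mult_distrib)
  finally have "\<bar>W - (- y\<^sup>2 / 2)\<bar> = \<bar>log_profile'' \<rho> \<xi> - log_profile'' \<rho> \<alpha>\<bar> * (\<tau>\<^sup>2 * y\<^sup>2 / 2)"
    by (simp only: abs_mult) simp
  also have "\<dots> \<le> e * \<kappa> * (\<tau>\<^sup>2 * y\<^sup>2 / 2)"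
    using bound by (intro mult_right_mono) auto
  also have "\<dots> = (\<kappa> * \<tau>\<^sup>2) * (e * y\<^sup>2 / 2)"
    by (simp add: mult_ac)
  also have "\<dots> = e * y\<^sup>2 / 2"
    using \<kappa>\<tau> by simp
  also have "\<dots> \<le> e * M\<^sup>2 / 2"
    using e y abs_le_square_iff[of y M] by (auto intro!: mult_left_mono)
  finally have "\<bar>W - (- y\<^sup>2 / 2)\<bar> \<le> e * M\<^sup>2 / 2" .
  then show ?thesis
    using abs_exp_diff_le[OF W, of "- y\<^sup>2 / 2"] h by simp
qed

text \<open>Extension by zero written as an indicator, the form in which affine substitution of
  Lebesgue integrals applies.\<close>

lemma rescaled_eq_indicator:
  "rescaled a b \<rho> \<alpha> y =
     (indicator {a..b} (\<alpha> + peak_scale \<rho> \<alpha> * y) *\<^sub>R \<rho> (\<alpha> + peak_scale \<rho> \<alpha> * y)) / max_value a b \<rho>"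
  by (simp add: rescaled_def indicator_def)

lemma integrable_rescaled:
  assumes P: "profile a b \<rho> \<alpha>"
  shows "integrable lborel (rescaled a b \<rho> \<alpha>)"
proof -
  have "integrable lborel (\<lambda>\<theta>. indicator {a..b} \<theta> *\<^sub>R \<rho> \<theta>)"
    using P by (simp add: profile_def set_integrable_def)
  then have "integrable lborel (\<lambda>y. (indicator {a..b} (\<alpha> + peak_scale \<rho> \<alpha> * y) *\<^sub>R
      \<rho> (\<alpha> + peak_scale \<rho> \<alpha> * y)) / max_value a b \<rho>)"
    using peak_scale_pos[OF P] by (intro integrable_divide lborel_integrable_real_affine) auto
  then show ?thesis
    by (simp add: rescaled_eq_indicator[abs_def])
qed

lemma integral_rescaled_pos:
  assumes P: "profile a b \<rho> \<alpha>"
  shows "0 < (LINT y|lborel. rescaled a b \<rho> \<alpha> y)"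
proof -
  have "0 < (LINT \<theta>|lborel. indicator {a..b} \<theta> *\<^sub>R \<rho> \<theta>)"
    using P by (simp add: profile_def set_lebesgue_integral_def)
  also have "\<dots> = \<bar>peak_scale \<rho> \<alpha>\<bar> *\<^sub>R (LINT y|lborel. indicator {a..b} (\<alpha> + peak_scale \<rho> \<alpha> * y) *\<^sub>R
      \<rho> (\<alpha> + peak_scale \<rho> \<alpha> * y))"
    using peak_scale_pos[OF P] by (intro lborel_integral_real_affine) auto
  finally show ?thesis
    using peak_scale_pos[OF P] max_value_pos[OF P]
    unfolding rescaled_eq_indicator integral_divide_zero by (simp add: zero_less_mult_iff)
qed

text \<open>Substitute \<theta> = \<alpha> + \<tau> y: the Jacobian \<tau> and the division by the
  maximum produce the prefactor of \<open>tail_mass\<close>. The tail hypothesis thus controls the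
  rescaled profiles directly.\<close>

lemma integral_rescaled_tail:
  assumes P: "profile a b \<rho> \<alpha>"
  shows "(LINT y:{y. M < \<bar>y\<bar>}|lborel. rescaled a b \<rho> \<alpha> y) = tail_mass a b \<rho> \<alpha> M"
proof -
  define \<tau> where "\<tau> = peak_scale \<rho> \<alpha>"
  have \<tau>: "0 < \<tau>" using peak_scale_pos[OF P] by (simp add: \<tau>_def)
  let ?A = "{\<theta>\<in>{a..b}. M * \<tau> < \<bar>\<theta> - \<alpha>\<bar>}"
  have "indicator {y. M < \<bar>y\<bar>} y *\<^sub>R rescaled a b \<rho> \<alpha> y =
      (indicator ?A (\<alpha> + \<tau> * y) *\<^sub>R \<rho> (\<alpha> + \<tau> * y)) / max_value a b \<rho>" for y
    using \<tau> by (auto simp: rescaled_def indicator_def \<tau>_def[symmetric] abs_mult mult.commute[of M])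
  then have "(LINT y:{y. M < \<bar>y\<bar>}|lborel. rescaled a b \<rho> \<alpha> y) =
      (LINT y|lborel. indicator ?A (\<alpha> + \<tau> * y) *\<^sub>R \<rho> (\<alpha> + \<tau> * y)) / max_value a b \<rho>"
    by (simp add: set_lebesgue_integral_def)
  moreover have "(LINT \<theta>|lborel. indicator ?A \<theta> *\<^sub>R \<rho> \<theta>) =
      \<bar>\<tau>\<bar> *\<^sub>R (LINT y|lborel. indicator ?A (\<alpha> + \<tau> * y) *\<^sub>R \<rho> (\<alpha> + \<tau> * y))"
    using \<tau> by (intro lborel_integral_real_affine) auto
  ultimately show ?thesis
    using \<tau> by (simp add: tail_mass_def set_lebesgue_integral_def \<tau>_def[symmetric])
qed

text \<open>Split the line at |y| = M. The pointwise estimate handles the core, and outside it |h -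
  g| is at most h + g.\<close>

lemma L1_dist_rescaled_gaussian_le:
  assumes P: "profile a b \<rho> \<alpha>" and osc: "osc a b \<rho> \<alpha> M \<le> ereal e" and M: "0 < M"
    and far: "M < infdist \<alpha> (frontier {a..b}) / peak_scale \<rho> \<alpha>"
  shows "(LINT y|lborel. \<bar>rescaled a b \<rho> \<alpha> y - exp (- y\<^sup>2 / 2)\<bar>)
    \<le> e * M ^ 3 + tail_mass a b \<rho> \<alpha> M + (LINT y:{y. M < \<bar>y\<bar>}|lborel. exp (- y\<^sup>2 / 2))"
proof -
  define \<tau> where "\<tau> = peak_scale \<rho> \<alpha>"
  define h where "h = rescaled a b \<rho> \<alpha>"
  define g where "g = (\<lambda>y::real. exp (- y\<^sup>2 / 2))"
  have \<tau>: "0 < \<tau>" using peak_scale_pos[OF P] by (simp add: \<tau>_def)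
  have \<alpha>: "a < \<alpha>" "\<alpha> < b" using P by (auto simp: profile_def)
  \<comment> \<open>Both end points lie in the frontier, so its distance from \<alpha> bounds both
    gaps, and the core |y| \<le> M is mapped into (a, b).\<close>
  have "a \<in> frontier {a..b}" "b \<in> frontier {a..b}"
    using \<alpha> by (auto simp: frontier_def interior_atLeastAtMost_real)
  then have "infdist \<alpha> (frontier {a..b}) \<le> \<alpha> - a" "infdist \<alpha> (frontier {a..b}) \<le> b - \<alpha>"
    using infdist_le[of a "frontier {a..b}" \<alpha>] infdist_le[of b "frontier {a..b}" \<alpha>] \<alpha>
    by (auto simp: dist_real_def)
  moreover have "M * \<tau> < infdist \<alpha> (frontier {a..b})"
    using far \<tau> by (simp add: \<tau>_def pos_less_divide_eq)
  ultimately have gap: "M * \<tau> < \<alpha> - a" "M * \<tau> < b - \<alpha>" by auto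
  have close: "\<bar>h y - g y\<bar> \<le> e * M\<^sup>2 / 2" if "\<bar>y\<bar> \<le> M" for y
  proof -
    have "\<bar>\<tau> * y\<bar> \<le> M * \<tau>"
      using that \<tau> by (simp add: abs_mult mult.commute)
    then have "\<alpha> + \<tau> * y \<in> {a<..<b}"
      using gap by auto
    then show ?thesis
      using rescaled_near_gaussian[OF P osc _ that] by (simp add: h_def g_def \<tau>_def)
  qed
  let ?B = "{y. M < \<bar>y\<bar>}"
  have B [measurable]: "?B \<in> sets lborel" by measurable
  have h_int: "integrable lborel h" and g_int: "integrable lborel g"
    unfolding h_def g_def by (rule integrable_rescaled[OF P] integrable_exp_neg_half_square)+
  have tail_int: "integrable lborel (\<lambda>y. indicator ?B y *\<^sub>R h y)"
    "integrable lborel (\<lambda>y. indicator ?B y *\<^sub>R g y)"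
    by (rule integrable_mult_indicator[OF B] h_int g_int)+
  have core_int: "integrable lborel (\<lambda>y. indicator {-M..M} y *\<^sub>R (e * M\<^sup>2 / 2))"
    using M by (intro integrable_scaleR_left integrable_real_indicator) (auto simp: emeasure_lborel_Icc)
  have "\<bar>h y - g y\<bar> \<le> indicator {-M..M} y *\<^sub>R (e * M\<^sup>2 / 2)
      + indicator ?B y *\<^sub>R h y + indicator ?B y *\<^sub>R g y" for y
  proof (cases "\<bar>y\<bar> \<le> M")
    case True
    then have "y \<in> {-M..M}" "y \<notin> ?B" by auto
    then show ?thesis using close[OF True] by simp
  next
    case False
    moreover have "\<bar>h y - g y\<bar> \<le> h y + g y"
      using rescaled_nonneg[OF P, of y] by (simp add: h_def g_def abs_le_iff)
    moreover have "y \<notin> {-M..M}" "y \<in> ?B" using False by auto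
    ultimately show ?thesis by simp
  qed
  then have "(LINT y|lborel. \<bar>h y - g y\<bar>) \<le> (LINT y|lborel. indicator {-M..M} y *\<^sub>R (e * M\<^sup>2 / 2)
      + indicator ?B y *\<^sub>R h y + indicator ?B y *\<^sub>R g y)"
    using h_int g_int tail_int core_int by (intro integral_mono) auto
  also have "\<dots> = (LINT y|lborel. indicator {-M..M} y *\<^sub>R (e * M\<^sup>2 / 2))
      + (LINT y:?B|lborel. h y) + (LINT y:?B|lborel. g y)"
    unfolding set_lebesgue_integral_def
    by (simp only: Bochner_Integration.integral_add Bochner_Integration.integrable_add tail_int core_int)
  \<comment> \<open>The core has length 2 M, and 2 M times \<open>e * M\<^sup>2 / 2\<close> is
    \<open>e * M ^ 3\<close>.\<close>
  also have "(LINT y|lborel. indicator {-M..M} y *\<^sub>R (e * M\<^sup>2 / 2)) = e * M ^ 3"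
    using M by (simp add: power2_eq_square power3_eq_cube)
  also have "(LINT y:?B|lborel. h y) = tail_mass a b \<rho> \<alpha> M"
    unfolding h_def by (rule integral_rescaled_tail[OF P])
  finally show ?thesis
    by (simp add: h_def g_def)
qed

section \<open>Passage to the limit\<close>

theorem theorem4p11:
  fixes a b :: real and \<rho> :: "nat \<Rightarrow> real \<Rightarrow> real" and \<alpha> :: "nat \<Rightarrow> real"
  assumes "\<And>n. profile a b (\<rho> n) (\<alpha> n)"
    and "filterlim (\<lambda>n. infdist (\<alpha> n) (frontier {a..b}) / peak_scale (\<rho> n) (\<alpha> n)) at_top sequentially"
    and "\<And>M. M > 0 \<Longrightarrow> (\<lambda>n. osc a b (\<rho> n) (\<alpha> n) M) \<longlonglongrightarrow> 0"
    and "((\<lambda>M. limsup (\<lambda>n. ereal (tail_mass a b (\<rho> n) (\<alpha> n) M))) \<longlongrightarrow> 0) at_top"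
  shows "(\<lambda>n. LINT y|lborel. \<bar>rescaled_density a b (\<rho> n) (\<alpha> n) y - std_normal_density y\<bar>)
           \<longlonglongrightarrow> 0
       \<and> (\<lambda>n. tv_dist (rescaled_density a b (\<rho> n) (\<alpha> n)) std_normal_density) \<longlonglongrightarrow> 0"
proof -
  note P = assms(1)
  define D where "D n = (LINT y|lborel. \<bar>rescaled a b (\<rho> n) (\<alpha> n) y - exp (- y\<^sup>2 / 2)\<bar>)" for n
  define E where
    "E n = (LINT y|lborel. \<bar>rescaled_density a b (\<rho> n) (\<alpha> n) y - std_normal_density y\<bar>)" for n
  have "D \<longlonglongrightarrow> 0"
  proof (rule tendstoI)
    fix \<epsilon> :: real assume \<epsilon>: "0 < \<epsilon>"
    \<comment> \<open>M is fixed first, making both tails smaller than a third of \<epsilon>; only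
      then does n grow.\<close>
    have "\<forall>\<^sub>F M in at_top. 0 < M
        \<and> limsup (\<lambda>n. ereal (tail_mass a b (\<rho> n) (\<alpha> n) M)) < ereal (\<epsilon> / 3)
        \<and> (LINT y:{y::real. M < \<bar>y\<bar>}|lborel. exp (- y\<^sup>2 / 2)) < \<epsilon> / 3"
      using \<epsilon>
      by (intro eventually_conj eventually_gt_at_top order_tendstoD(2)[OF assms(4)]
          order_tendstoD(2)[OF integral_outside_ball_tendsto_0[OF integrable_exp_neg_half_square]]) auto
    then obtain M :: real where M: "0 < M"
      and tail: "limsup (\<lambda>n. ereal (tail_mass a b (\<rho> n) (\<alpha> n) M)) < ereal (\<epsilon> / 3)"
      and gauss: "(LINT y:{y::real. M < \<bar>y\<bar>}|lborel. exp (- y\<^sup>2 / 2)) < \<epsilon> / 3"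
      by (auto dest: eventually_happens)
    \<comment> \<open>This threshold turns the core contribution \<open>e * M ^ 3\<close> into
      \<epsilon> / 3.\<close>
    have "0 < ereal (\<epsilon> / 3 / M ^ 3)"
      using \<epsilon> M by simp
    then have "\<forall>\<^sub>F n in sequentially. osc a b (\<rho> n) (\<alpha> n) M < ereal (\<epsilon> / 3 / M ^ 3)"
      by (rule order_tendstoD(2)[OF assms(3)[OF M]])
    moreover have "\<forall>\<^sub>F n in sequentially. M < infdist (\<alpha> n) (frontier {a..b}) / peak_scale (\<rho> n) (\<alpha> n)"
      using assms(2) by (simp add: filterlim_at_top_dense)
    ultimately show "\<forall>\<^sub>F n in sequentially. dist (D n) 0 < \<epsilon>"
      using Limsup_lessD[OF tail]
    proof eventually_elim
      case (elim n)
      have "D n \<le> \<epsilon> / 3 / M ^ 3 * M ^ 3 + tail_mass a b (\<rho> n) (\<alpha> n) M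
          + (LINT y:{y. M < \<bar>y\<bar>}|lborel. exp (- y\<^sup>2 / 2))"
        unfolding D_def using elim P M by (intro L1_dist_rescaled_gaussian_le) auto
      then have "D n < \<epsilon>"
        using elim gauss M by simp
      moreover have "0 \<le> D n"
        by (simp add: D_def)
      ultimately show ?case by simp
    qed
  qed
  then have "(\<lambda>n. 2 * D n / sqrt (2 * pi)) \<longlonglongrightarrow> 2 * 0 / sqrt (2 * pi)"
    by (intro tendsto_intros) auto
  \<comment> \<open>Dividing exp (- y^2 / 2) by its mass sqrt (2 pi) yields
    \<open>std_normal_density\<close>, so \<open>E n\<close> is the L1 distance of the two
    normalised functions.\<close>
  moreover have "E n \<le> 2 * D n / sqrt (2 * pi)" for n
    using L1_dist_normalized_le[OF integrable_rescaled[OF P] integrable_exp_neg_half_square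
        rescaled_nonneg[OF P] integral_rescaled_pos[OF P], of n]
    unfolding integral_exp_neg_half_square by (simp add: E_def D_def rescaled_density_def std_normal_density_def)
  moreover have "0 \<le> E n" for n
    by (simp add: E_def)
  ultimately have "E \<longlonglongrightarrow> 0"
    by (intro tendsto_sandwich[of "\<lambda>_. 0" E sequentially "\<lambda>n. 2 * D n / sqrt (2 * pi)"]) auto
  then show ?thesis
    using tendsto_mult_left[of E 0 sequentially "1 / 2"]
    by (simp add: E_def[abs_def] tv_dist_def)
qed

end
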